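(* For every integer $n\geq 4$, the $n$-dimensional twisted hypercube $H_n$ satisfies $\kappa(H_{n}; K_{1,4})=\kappa^{s}(H_{n}; K_{1,4})=\lceil\frac{n}{2}\rceil$.
   Context: **Twisted hypercube.** Define an integer function $\kappa$ by $\kappa(1)=0$ and $\kappa(n)=\max\{1,\lceil \log_2 n-2\log_2\log_2 n\rceil\}$ for $n\ge 2$. Let $Z_2^n$ be the set of binary strings $x=x_1x_2\cdots x_n$ of length $n$. For $x\in Z_2^n$ ($n\ge1$), $\phi(x)\in Z_2^n$ is the string with $\phi(x)_j=x_j+x_{n-\kappa(n)+j} \pmod 2$ for $1\le j\le \kappa(n)$ and $\phi(x)_j=x_j$ for $\kappa(n)<j\le n$ ($\phi$ is an involution on $Z_2^n$). The graph $H_1$ is $K_2$ with vertices $0,1$. For $n\ge 2$, $H_n$ has vertex set $Z_2^n$ and is obtained from two copies $0H_{n-1}$ and $1H_{n-1}$ of $H_{n-1}$ (vertices prefixed by $0$ and $1$ respectively) by adding the edges joining $0x$ and $1\phi(x)$ for all $x\in Z_2^{n-1}$. **Structure connectivity.** Let $G$ be a graph and $T$ a connected graph that is isomorphic to a subgraph of $G$. For a set $\mathcal F$ of subgraphs of $G$ (not required to be disjoint), $G-\mathcal F$ is the subgraph of $G$ induced by the vertices belonging to no member of $\mathcal F$. $\mathcal F$ is a $T$-structure-cut if every member is isomorphic to $T$ and $G-\mathcal F$ is disconnected; it is a $T$-substructure-cut if every member is isomorphic to a connected subgraph of $T$ and $G-\mathcal F$ is disconnected. $\kappa(G;T)$ (resp.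 $\kappa^s(G;T)$) is the minimum cardinality of a $T$-structure-cut (resp. $T$-substructure-cut) of $G$. $K_{1,r}$ is the star with $r$ leaves. *)

theory Defs
  imports Complex_Main "Graph_Theory.Graph_Theory"
begin

text \<open>
  Undirected graphs are the symmetric digraphs of the Graph Theory entry: an edge joining
  \<open>u\<close> and \<open>v\<close> is the pair of arcs \<open>(u, v)\<close>, \<open>(v, u)\<close>.
\<close>

section \<open>Structure connectivity\<close>

definition delete_subgraphs ::
    "'a pair_pre_digraph \<Rightarrow> 'a pair_pre_digraph set \<Rightarrow> ('a, 'a \<times> 'a) pre_digraph" where
  "delete_subgraphs G \<F> = with_proj G \<restriction> (pverts G - (\<Union>S\<in>\<F>. pverts S))"

text \<open>
  The library predicate \<open>connected\<close> is false for the graph without vertices, which is not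
  regarded as disconnected here.
\<close>

definition disconnected :: "('a, 'b) pre_digraph \<Rightarrow> bool" where
  "disconnected G \<longleftrightarrow> verts G \<noteq> {} \<and> \<not> Digraph_Component.connected G"

definition structure_cut ::
    "'a pair_pre_digraph \<Rightarrow> 'b pair_pre_digraph \<Rightarrow> 'a pair_pre_digraph set \<Rightarrow> bool" where
  "structure_cut G T \<F> \<longleftrightarrow>
     (\<forall>S\<in>\<F>. subgraph (with_proj S) (with_proj G) \<and> digraph_iso (with_proj S) (with_proj T)) \<and>
     disconnected (delete_subgraphs G \<F>)"

text \<open>
  Subgraphs in the library sense need not be symmetric; \<open>pair_graph R\<close> makes \<open>R\<close>, and hence
  \<open>S\<close>, an undirected graph.  Connectedness makes it nonempty.
\<close>

definition substructure_cut ::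
    "'a pair_pre_digraph \<Rightarrow> 'b pair_pre_digraph \<Rightarrow> 'a pair_pre_digraph set \<Rightarrow> bool" where
  "substructure_cut G T \<F> \<longleftrightarrow>
     (\<forall>S\<in>\<F>. subgraph (with_proj S) (with_proj G) \<and>
        (\<exists>R. pair_graph R \<and> subgraph (with_proj R) (with_proj T) \<and>
             Digraph_Component.connected (with_proj R) \<and>
             digraph_iso (with_proj S) (with_proj R))) \<and>
     disconnected (delete_subgraphs G \<F>)"

text \<open>
  The minimum over the empty set of cuts is \<open>0\<close> by convention.  This cannot be confused with an
  attained minimum if \<open>G\<close> is connected, since then a cut has at least one member.
\<close>

definition structure_connectivity ::
    "'a pair_pre_digraph \<Rightarrow> 'b pair_pre_digraph \<Rightarrow> nat" where
  "structure_connectivity G T = Inf {card \<F> | \<F>. finite \<F> \<and> structure_cut G T \<F>}"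

definition substructure_connectivity ::
    "'a pair_pre_digraph \<Rightarrow> 'b pair_pre_digraph \<Rightarrow> nat" where
  "substructure_connectivity G T = Inf {card \<F> | \<F>. finite \<F> \<and> substructure_cut G T \<F>}"

definition star :: "nat \<Rightarrow> nat pair_pre_digraph" where
  "star r = \<lparr> pverts = {0..r}, parcs = {0} \<times> {1..r} \<union> {1..r} \<times> {0} \<rparr>"


section \<open>The twisted hypercube\<close>

definition twist_width :: "nat \<Rightarrow> nat" where
  "twist_width n =
     (if n = 1 then 0
      else nat (max 1 \<lceil>log 2 (real n) - 2 * log 2 (log 2 (real n))\<rceil>))"

text \<open>
  Binary strings are lists of Booleans, so addition modulo 2 is \<open>\<noteq>\<close>.  List positions are
  counted from 0: the \<open>j\<close>-th letter of \<open>x\<close> is \<open>x ! (j - 1)\<close>.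
\<close>

definition twist :: "bool list \<Rightarrow> bool list" where
  "twist x =
     (let n = length x; k = twist_width n
      in map (\<lambda>j. if j < k then x ! j \<noteq> x ! (n - k + j) else x ! j) [0..<n])"

text \<open>
  \<open>twisted_hypercube 0\<close> is a dummy value: the family starts at dimension 1.
\<close>

fun twisted_hypercube :: "nat \<Rightarrow> bool list pair_pre_digraph" where
  "twisted_hypercube 0 = \<lparr> pverts = {}, parcs = {} \<rparr>"
| "twisted_hypercube (Suc 0) =
     \<lparr> pverts = {[False], [True]}, parcs = {([False], [True]), ([True], [False])} \<rparr>"
| "twisted_hypercube (Suc (Suc m)) =
     \<lparr> pverts = {x. length x = Suc (Suc m)},
       parcs =
         {(b # x, b # y) | b x y. (x, y) \<in> parcs (twisted_hypercube (Suc m))} \<union>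
         {(False # x, True # twist x) | x. length x = Suc m} \<union>
         {(True # twist x, False # x) | x. length x = Suc m} \<rparr>"

end

theory Submission
  imports Defs
begin

text \<open>
  Every vertex set of a star lies in the closed neighbourhood of its centre.  The lower bound
  follows by giving a deleted star the weight 2 and a deleted single vertex the weight 1: faults of
  total weight less than \<open>n\<close> leave \<open>H\<^sub>n\<close> connected, however many
  leaves the stars have.  Indeed, a star centred in one half of \<open>H\<^sub>n\<close> meets
  the other half in at most one vertex.  If both halves contain a centre or a single fault, each
  half has weight less than \<open>n - 1\<close>, so both stay connected by induction, and some
  edge between them survives because there are too few deleted vertices.  If one half contains
  neither, it stays connected by induction, and each surviving vertex of the other half is joined
  to a surviving vertex of it, since only partners of (deleted) centres are deleted there.

  For the upper bound, the neighbours of the zero string are the unit strings, and two consecutive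
  unit strings have a common neighbour that is not adjacent to the zero string.  The stars
  centred at these vertices isolate the zero string.
\<close>

section \<open>Adjacency in the twisted hypercube\<close>

lemma square_le_power_two:
  fixes n :: nat
  assumes "4 \<le> n"
  shows "n\<^sup>2 \<le> 2 ^ n"
  using assms
proof (induction n rule: nat_induct_at_least)
  case base
  then show ?case by simp
next
  case (Suc n)
  have "4 * n \<le> n * n" using Suc.hyps by simp
  then have "2 * n + 1 \<le> n * n" using Suc.hyps by linarith
  then have "(Suc n)\<^sup>2 \<le> 2 * n\<^sup>2"
    by (simp add: power2_eq_square)
  then show ?case using Suc.IH by simp
qed

text \<open>The prefix changed by \<open>twist\<close> and the suffix added to it are then disjoint
  blocks. For n >= 4 the bound comes from log n <= n/2 and log log n >= 1; smaller dimensions are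
  checked by hand.\<close>

lemma two_twist_width_le:
  assumes "n \<noteq> 0"
  shows "2 * twist_width n \<le> n"
proof -
  consider "n = 1" | "n = 2" | "n = 3" | "4 \<le> n" using assms by linarith
  then show ?thesis
  proof cases
    case 1
    then show ?thesis by (simp add: twist_width_def)
  next
    case 2
    then show ?thesis by (simp add: twist_width_def)
  next
    case 3
    \<comment> \<open>Squaring reduces the two estimates log 3 >= 3/2 and log (3/2) >= 1/2 to 8 <= 9
      and 2 <= 9/4. With log 3 <= 2 they bound the expression under the ceiling by 2 - 1.\<close>
    have "log 2 (2 powr (3 / 2)) \<le> log 2 3"
    proof (subst log_le_cancel_iff)
      have "(2 powr (3 / 2))\<^sup>2 \<le> (3 :: real)\<^sup>2"
        by (simp add: power2_eq_square flip: powr_add)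
      then show "2 powr (3 / 2) \<le> (3 :: real)" by (rule power2_le_imp_le) simp
    qed auto
    then have a: "3 / 2 \<le> log 2 3" by simp
    have "log 2 (2 powr (1 / 2)) \<le> log 2 (3 / 2)"
    proof (subst log_le_cancel_iff)
      have "(2 powr (1 / 2))\<^sup>2 \<le> (3 / 2 :: real)\<^sup>2"
        by (simp add: power2_eq_square flip: powr_add)
      then show "2 powr (1 / 2) \<le> (3 / 2 :: real)" by (rule power2_le_imp_le) simp
    qed auto
    also have "\<dots> \<le> log 2 (log 2 3)" using a by (subst log_le_cancel_iff) auto
    finally have b: "1 / 2 \<le> log 2 (log 2 3)" by simp
    have "log 2 3 \<le> 2" by (subst log_le_iff) auto
    then have "\<lceil>log 2 3 - 2 * log 2 (log 2 3)\<rceil> \<le> 1" using b by (simp add: ceiling_le_iff)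
    then show ?thesis using 3 by (simp add: twist_width_def)
  next
    case 4
    have a: "2 \<le> log 2 (real n)" using 4 by (subst le_log_iff) auto
    have b: "1 \<le> log 2 (log 2 (real n))"
      using a by (subst le_log_iff) auto
    have "(real n)\<^sup>2 \<le> 2 ^ n"
      using square_le_power_two[OF 4]
      by (metis of_nat_le_iff of_nat_numeral of_nat_power)
    then have "log 2 ((real n)\<^sup>2) \<le> log 2 (2 ^ n)" using 4 by (subst log_le_cancel_iff) auto
    then have "2 * log 2 (real n) \<le> n" using 4 by (simp add: log_nat_power)
    then have "log 2 (real n) - 2 * log 2 (log 2 (real n)) \<le> n / 2 - 2" using b by simp
    then have "2 * real_of_int \<lceil>log 2 (real n) - 2 * log 2 (log 2 (real n))\<rceil> \<le> n"
      by linarith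
    then have "2 * \<lceil>log 2 (real n) - 2 * log 2 (log 2 (real n))\<rceil> \<le> n" by linarith
    then show ?thesis using 4 by (simp add: twist_width_def)
  qed
qed

lemma length_twist [simp]: "length (twist x) = length x"
  by (simp add: twist_def Let_def)

text \<open>The letters added to the prefix lie outside it and stay fixed, so the second application
  adds the same letters and cancels the first.\<close>

lemma twist_twist [simp]: "twist (twist x) = x"
proof (cases "x = []")
  case True
  then show ?thesis by (simp add: twist_def)
next
  case False
  then have k: "2 * twist_width (length x) \<le> length x" by (intro two_twist_width_le) simp
  have nth: "twist y ! j = (if j < twist_width (length y) then
      y ! j \<noteq> y ! (length y - twist_width (length y) + j) else y ! j)" if "j < length y" for y j
    using that by (simp add: twist_def Let_def)
  show ?thesis
    by (rule nth_equalityI) (use k in \<open>auto simp: nth\<close>)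
qed

lemma twist_eq_iff [simp]: "twist x = twist y \<longleftrightarrow> x = y"
  by (metis twist_twist)

section \<open>Recursion, symmetry and regularity of adjacency\<close>

abbreviation adj :: "nat \<Rightarrow> bool list rel" where
  "adj n \<equiv> parcs (twisted_hypercube n)"

lemma pverts_twisted_hypercube: "n \<noteq> 0 \<Longrightarrow> pverts (twisted_hypercube n) = {x. length x = n}"
  by (cases n rule: twisted_hypercube.cases) (auto simp: length_Suc_conv)

lemma adj_0: "adj 0 = {}"
  by simp

text \<open>As \<open>twist\<close> is an involution, both directions of a cross edge have the same
  form. The rule also produces dimension 1 from a formal dimension 0 whose only vertex is the empty
  string, so inductions can start at 0.\<close>

lemma adj_Suc:
  "(u, v) \<in> adj (Suc n) \<longleftrightarrow>
    (\<exists>b x y. u = b # x \<and> v = b # y \<and> (x, y) \<in> adj n) \<or>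
    (\<exists>b x. length x = n \<and> u = b # x \<and> v = (\<not> b) # twist x)"
proof (cases n)
  case 0
  have "twist [] = []" by (simp add: twist_def)
  then show ?thesis using 0 by (auto simp: ex_bool_eq)
next
  case (Suc m)
  have "(\<exists>b x. length x = n \<and> u = b # x \<and> v = (\<not> b) # twist x) \<longleftrightarrow>
      (\<exists>x. length x = n \<and> u = False # x \<and> v = True # twist x) \<or>
      (\<exists>x. length x = n \<and> v = False # x \<and> u = True # twist x)"
    by (auto simp: ex_bool_eq)
  then show ?thesis unfolding Suc by (simp del: twisted_hypercube.simps(2)) blast
qed

declare twisted_hypercube.simps [simp del]

lemma adj_length: "(x, y) \<in> adj n \<Longrightarrow> length x = n \<and> length y = n"
proof (induction n arbitrary: x y)
  case (Suc n)
  then show ?case unfolding adj_Suc by (elim disjE exE conjE) simp_all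
qed (simp add: adj_0)

lemma adj_sym: "(x, y) \<in> adj n \<Longrightarrow> (y, x) \<in> adj n"
proof (induction n arbitrary: x y)
  case 0
  then show ?case by (simp add: adj_0)
next
  case (Suc n)
  from Suc.prems[unfolded adj_Suc] show ?case
  proof (elim disjE exE conjE)
    fix b x' y'
    assume "x = b # x'" "y = b # y'" "(x', y') \<in> adj n"
    then show ?thesis using Suc.IH by (auto simp: adj_Suc)
  next
    fix b x'
    assume "length x' = n" "x = b # x'" "y = (\<not> b) # twist x'"
    then show ?thesis by (intro adj_Suc[THEN iffD2] disjI2 exI[of _ "\<not> b"] exI[of _ "twist x'"]) simp
  qed
qed

lemma adj_irrefl: "(x, x) \<notin> adj n"
proof (induction n arbitrary: x)
  case (Suc n)
  then show ?case unfolding adj_Suc by fastforce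
qed (simp add: adj_0)

lemma adj_Cons:
  "(b # x, c # y) \<in> adj (Suc n) \<longleftrightarrow>
    (if b = c then (x, y) \<in> adj n else length x = n \<and> y = twist x)"
  by (auto simp: adj_Suc)

lemma Image_adj_Cons:
  "length x = n \<Longrightarrow> adj (Suc n) `` {b # x} = insert ((\<not> b) # twist x) (Cons b ` (adj n `` {x}))"
  unfolding adj_Suc by (intro set_eqI) (simp add: Image_singleton_iff image_iff adj_Suc, blast)

lemma finite_card_Image_adj:
  "length x = n \<Longrightarrow> finite (adj n `` {x}) \<and> card (adj n `` {x}) = n"
proof (induction n arbitrary: x)
  case 0
  then show ?case by (simp add: adj_0)
next
  case (Suc n)
  then obtain b z where x: "x = b # z" and z: "length z = n" by (cases x) auto
  have "(\<not> b) # twist z \<notin> Cons b ` (adj n `` {z})" by auto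
  moreover have "card (Cons b ` (adj n `` {z})) = n"
    using Suc.IH[OF z] by (simp add: card_image)
  ultimately show ?case
    unfolding x Image_adj_Cons[OF z] using Suc.IH[OF z] by simp
qed

section \<open>Connectedness after deletion of stars\<close>

text \<open>
  The sets \<open>A\<close> and \<open>B\<close> are the centres of the deleted stars and the
  single deleted vertices.  Truncated subtraction covers \<open>n = 0\<close>, where the graph is
  regarded as having the empty string as its only vertex.
\<close>

lemma fault_connected:
  assumes "finite A" "finite B" "A \<subseteq> X" "X \<subseteq> A \<union> B \<union> adj n `` A"
    and "2 * card A + card B \<le> n - 1"
    and "length u = n" "length v = n" "u \<notin> X" "v \<notin> X"
  shows "(u, v) \<in> (adj n \<inter> (- X) \<times> (- X))\<^sup>*"
  using assms
proof (induction n arbitrary: A B X u v)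
  case 0
  then show ?case by simp
next
  case (Suc m)
  define half :: "bool \<Rightarrow> bool list set \<Rightarrow> bool list set" where "half b S = {x. b # x \<in> S}" for b S
  let ?R = "adj (Suc m) \<inter> (- X) \<times> (- X)"
  have half_image: "Cons b ` half b S \<subseteq> S" for b S by (auto simp: half_def)
  have fin: "finite (half b S)" if "finite S" for b S
    using finite_subset[OF half_image that] by (rule finite_imageD) simp
  have card_half: "card (half b S) + card (half (\<not> b) S) \<le> card S" if "finite S" for b S
  proof -
    have "card (half b S) + card (half (\<not> b) S) = card (Cons b ` half b S) + card (Cons (\<not> b) ` half (\<not> b) S)"
      by (simp add: card_image)
    also have "\<dots> = card (Cons b ` half b S \<union> Cons (\<not> b) ` half (\<not> b) S)"
      by (rule card_Un_disjoint[symmetric]) (use fin[OF that] in auto)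
    also have "\<dots> \<le> card S"
      by (rule card_mono[OF that]) (use half_image in auto)
    finally show ?thesis .
  qed
  have sym: "(y, x) \<in> ?R\<^sup>*" if "(x, y) \<in> ?R\<^sup>*" for x y
  proof -
    have "sym ?R" by (auto intro!: symI adj_sym)
    then show ?thesis using that by (blast dest: sym_rtrancl symD)
  qed
  \<comment> \<open>A star centred in the other copy meets copy \<open>b\<close> at most in the
    partner of its centre. Such partners join the single faults, of weight 1.\<close>
  have halfX: "half b X \<subseteq> half b A \<union> (half b B \<union> twist ` half (\<not> b) A) \<union> adj m `` half b A" for b
  proof
    fix x assume "x \<in> half b X"
    then have "b # x \<in> A \<union> B \<union> adj (Suc m) `` A" using Suc.prems(4) by (auto simp: half_def)
    then show "x \<in> half b A \<union> (half b B \<union> twist ` half (\<not> b) A) \<union> adj m `` half b A"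
    proof (elim UnE ImageE)
      fix a assume "(a, b # x) \<in> adj (Suc m)" "a \<in> A"
      then show ?thesis unfolding adj_Suc by (auto simp: half_def)
    qed (simp_all add: half_def)
  qed
  have half_connected: "(b # x, b # y) \<in> ?R\<^sup>*"
    if w: "2 * card (half b A) + card (half b B) + card (half (\<not> b) A) \<le> m - 1"
      and "length x = m" "length y = m" "b # x \<notin> X" "b # y \<notin> X" for b x y
  proof -
    have c: "card (half b B \<union> twist ` half (\<not> b) A) \<le> card (half b B) + card (half (\<not> b) A)"
      by (rule order_trans[OF card_Un_le]) (simp add: card_image_le fin Suc.prems)
    have "(x, y) \<in> (adj m \<inter> (- half b X) \<times> (- half b X))\<^sup>*"
    proof (intro Suc.IH)
      show "finite (half b A)" "finite (half b B \<union> twist ` half (\<not> b) A)"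
        using fin Suc.prems(1,2) by blast+
      show "half b A \<subseteq> half b X" using Suc.prems(3) by (auto simp: half_def)
      show "half b X \<subseteq> half b A \<union> (half b B \<union> twist ` half (\<not> b) A) \<union> adj m `` half b A"
        by (rule halfX)
      show "2 * card (half b A) + card (half b B \<union> twist ` half (\<not> b) A) \<le> m - 1"
        using w c by linarith
      show "length x = m" "length y = m" "x \<notin> half b X" "y \<notin> half b X"
        using that by (simp_all add: half_def)
    qed
    then show ?thesis
    proof (induction rule: rtrancl_induct)
      case (step y z)
      have "(b # y, b # z) \<in> ?R" using step.hyps(2) by (auto simp: half_def adj_Cons)
      with step.IH show ?case by (rule rtrancl_into_rtrancl)
    qed simp
  qed
  note cA = card_half[OF Suc.prems(1)] and cB = card_half[OF Suc.prems(2)]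
  obtain c z where u: "u = c # z" and z: "length z = m" using Suc.prems(6) by (cases u) auto
  obtain d w where v: "v = d # w" and w: "length w = m" using Suc.prems(7) by (cases v) auto
  show ?case
  proof (cases "\<exists>b. half b A = {} \<and> half b B = {}")
    case True
    then obtain b where b: "half b A = {}" "half b B = {}" by auto
    have reach: "\<exists>x. length x = m \<and> b # x \<notin> X \<and> (a # y, b # x) \<in> ?R\<^sup>*"
      if y: "length y = m" "a # y \<notin> X" for a y
    proof (cases "a = b")
      case True
      then show ?thesis using y by auto
    next
      case False
      then have a: "a = (\<not> b)" by auto
      \<comment> \<open>Centres are deleted, so the survivor \<open>y\<close> is not one. Since
        \<open>twist\<close> is injective, its partner is no partner of a centre, and nothing else
        can be deleted in copy \<open>b\<close>.\<close>
      have "y \<notin> half (\<not> b) A" using y Suc.prems(3) unfolding a by (auto simp: half_def)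
      then have "twist y \<notin> half b X" using halfX[of b] b by auto
      then have "(a # y, b # twist y) \<in> ?R" using y by (auto simp: half_def adj_Cons a)
      then show ?thesis using y by (intro exI[of _ "twist y"]) auto
    qed
    obtain x where x: "length x = m" "b # x \<notin> X" "(u, b # x) \<in> ?R\<^sup>*"
      using reach z Suc.prems(8) u by blast
    obtain y where y: "length y = m" "b # y \<notin> X" "(v, b # y) \<in> ?R\<^sup>*"
      using reach w Suc.prems(9) v by blast
    \<comment> \<open>The faults in this copy are at most \<open>card A\<close> partners, and
      \<open>2 * card A <= m\<close> yields \<open>card A <= m - 1\<close>, also for empty
      \<open>A\<close>.\<close>
    have "(b # x, b # y) \<in> ?R\<^sup>*"
      using cA[of b] b Suc.prems(5) x y by (intro half_connected) auto
    then show ?thesis using x(3) sym[OF y(3)] by (blast intro: rtrancl_trans)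
  next
    case False
    have pos: "card (half b A) + card (half b B) \<ge> 1" for b
    proof -
      have "half b A \<noteq> {} \<or> half b B \<noteq> {}" using False by simp
      then have "0 < card (half b A) \<or> 0 < card (half b B)"
        using fin Suc.prems(1,2) by (simp add: card_gt_0_iff)
      then show ?thesis by linarith
    qed
    \<comment> \<open>Seen from copy \<open>b\<close>, each centre in the other copy drops from
      weight 2 to 1 and each single fault there from 1 to 0. By \<open>pos\<close> the weight falls
      by at least 1, as the induction requires.\<close>
    have conn: "(b # x, b # y) \<in> ?R\<^sup>*"
      if "length x = m" "length y = m" "b # x \<notin> X" "b # y \<notin> X" for b x y
      using that cA[of b] cB[of b] pos[of "\<not> b"] Suc.prems(5) by (intro half_connected) auto
    have cardX: "finite X \<and> card X \<le> (m + 2) * card A + card B"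
    proof -
      have N: "finite (insert a (adj (Suc m) `` {a})) \<and> card (insert a (adj (Suc m) `` {a})) \<le> m + 2" for a
      proof (cases "length a = Suc m")
        case True
        then show ?thesis using finite_card_Image_adj[OF True] by (simp add: card_insert_if)
      next
        \<comment> \<open>\<open>A\<close> may contain strings of the wrong length; these have no
          neighbours.\<close>
        case False
        then have "adj (Suc m) `` {a} = {}" using adj_length by blast
        then show ?thesis by simp
      qed
      have sub: "X \<subseteq> (\<Union>a\<in>A. insert a (adj (Suc m) `` {a})) \<union> B" using Suc.prems(4) by blast
      have f: "finite ((\<Union>a\<in>A. insert a (adj (Suc m) `` {a})) \<union> B)"
        using N Suc.prems(1,2) by simp
      have "card ((\<Union>a\<in>A. insert a (adj (Suc m) `` {a})) \<union> B) \<le>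
          card (\<Union>a\<in>A. insert a (adj (Suc m) `` {a})) + card B"
        by (rule card_Un_le)
      also have "card (\<Union>a\<in>A. insert a (adj (Suc m) `` {a})) \<le> (\<Sum>a\<in>A. card (insert a (adj (Suc m) `` {a})))"
        by (rule card_UN_le[OF Suc.prems(1)])
      also have "\<dots> \<le> (\<Sum>a\<in>A. m + 2)" by (rule sum_mono) (use N in blast)
      finally have "card ((\<Union>a\<in>A. insert a (adj (Suc m) `` {a})) \<union> B) \<le> (m + 2) * card A + card B"
        by (simp add: mult.commute)
      then show ?thesis using finite_subset[OF sub f] card_mono[OF f sub] by linarith
    qed
    have ab: "card A + card B \<ge> 2"
      using pos[of True] pos[of False] cA[of True] cB[of True] by simp
    have wt: "2 * card A + card B \<le> m" using Suc.prems(5) by simp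
    \<comment> \<open>For m <= 2 two faults fit the weight bound only as single faults with m = 2.
      Otherwise twice the left side is at most (m + 2) * m = (m + 1)^2 - 1, which is below 2^(m +
      1).\<close>
    have count: "(m + 2) * card A + card B < 2 ^ m"
    proof (cases "m \<le> 2")
      case True
      then have "card A = 0 \<and> card B = 2 \<and> m = 2" using ab wt by linarith
      then show ?thesis by simp
    next
      case False
      have "2 * ((m + 2) * card A + card B) \<le> (m + 2) * (2 * card A + card B)"
        by (simp add: algebra_simps)
      also have "\<dots> \<le> (m + 2) * m" using wt by (rule mult_left_mono) simp
      also have "\<dots> < (Suc m)\<^sup>2" by (simp add: power2_eq_square)
      also have "\<dots> \<le> 2 ^ Suc m" using False by (intro square_le_power_two) simp
      finally show ?thesis by simp
    qed
    \<comment> \<open>\<open>h\<close> maps a vertex to the string \<open>x\<close> naming the cross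
      edge between \<open>False # x\<close> and \<open>True # twist x\<close> that contains it.
      There are 2^m cross edges and fewer deleted vertices, so one edge survives.\<close>
    define h where "h l = (if hd l then twist (tl l) else tl l)" for l
    have lt: "card (h ` X) < card {x :: bool list. length x = m}"
      using card_image_le[of X h] cardX count card_lists_length_eq[of "UNIV :: bool set" m] by simp
    have "\<not> {x :: bool list. length x = m} \<subseteq> h ` X"
    proof
      assume "{x. length x = m} \<subseteq> h ` X"
      with cardX have "card {x :: bool list. length x = m} \<le> card (h ` X)"
        by (intro card_mono) auto
      with lt show False by simp
    qed
    then obtain x where x: "length x = m" "x \<notin> h ` X" by auto
    have "h (False # x) = x" "h (True # twist x) = x" by (simp_all add: h_def)
    then have x0: "False # x \<notin> X" and x1: "True # twist x \<notin> X"
      using x(2) rev_image_eqI[of _ X _ h] by fastforce+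
    have "(False # x, True # twist x) \<in> ?R" using x0 x1 x by (auto simp: adj_Cons)
    then have cross: "(False # x, True # twist x) \<in> ?R\<^sup>*" by auto
    have "(u, False # x) \<in> ?R\<^sup>*" if "length z = m" "c # z \<notin> X" "u = c # z" for u c z
    proof (cases c)
      case True
      then have "(u, True # twist x) \<in> ?R\<^sup>*" using that x x1 conn by auto
      then show ?thesis by (rule rtrancl_trans[OF _ sym[OF cross]])
    next
      case False
      then show ?thesis using that x x0 conn by auto
    qed
    then have "(u, False # x) \<in> ?R\<^sup>*" "(v, False # x) \<in> ?R\<^sup>*"
      using u v z w Suc.prems(8,9) by blast+
    then show ?thesis using sym rtrancl_trans by metis
  qed
qed

section \<open>Graphs with deleted subgraphs\<close>

text \<open>The library symmetrises a graph before testing reachability within its vertex set. A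
  symmetric arc relation is unchanged by this, so plain reachability remains; \<open>u\<close> and
  \<open>v\<close> also witness that some vertex is left.\<close>

lemma disconnected_delete_subgraphs_iff:
  fixes G :: "'a pair_pre_digraph" and \<F> :: "'a pair_pre_digraph set"
  assumes "sym (parcs G)"
  defines "W \<equiv> pverts G - (\<Union>S\<in>\<F>. pverts S)"
  shows "disconnected (delete_subgraphs G \<F>) \<longleftrightarrow>
    (\<exists>u\<in>W. \<exists>v\<in>W. (u, v) \<notin> (parcs G \<inter> W \<times> W)\<^sup>*)"
proof -
  let ?R = "parcs G \<inter> W \<times> W"
  have verts: "verts (delete_subgraphs G \<F>) = W"
    by (simp add: delete_subgraphs_def W_def)
  have "parcs (mk_symmetric (delete_subgraphs G \<F>)) = ?R"
    using symD[OF assms(1)]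
    unfolding parcs_mk_symmetric delete_subgraphs_def W_def[symmetric] by fastforce
  then have reach: "u \<rightarrow>\<^sup>*\<^bsub>mk_symmetric (delete_subgraphs G \<F>)\<^esub> v \<longleftrightarrow> (u, v) \<in> ?R\<^sup>*"
    if "u \<in> W" "v \<in> W" for u v
    using that rtrancl_consistent_rtrancl_on[of u v ?R W] rtrancl_on_rtranclI[of u v W ?R]
    by (auto simp: reachable_def verts)
  show ?thesis
    unfolding disconnected_def Digraph_Component.connected_def strongly_connected_def
    using reach by (auto simp: verts)
qed

text \<open>If 0 is present, connectedness gives every other vertex an incident arc, whose other end
  must be 0. If 0 is absent there are no arcs, so the only vertex is its own centre.\<close>

lemma connected_subgraph_of_star_has_centre:
  assumes sub: "subgraph (with_proj R) (with_proj (star r))"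
    and conn: "Digraph_Component.connected (with_proj R)"
  obtains d where "d \<in> pverts R"
    and "\<And>y. y \<in> pverts R \<Longrightarrow> y = d \<or> (d, y) \<in> parcs R \<or> (y, d) \<in> parcs R"
proof -
  have arcs: "x = 0 \<or> y = 0" if "(x, y) \<in> parcs R" for x y
    using sub that by (auto simp: subgraph_def star_def)
  have wf: "x \<in> pverts R \<and> y \<in> pverts R" if "(x, y) \<in> parcs R" for x y
    using sub that by (auto simp: subgraph_def wf_digraph_def)
  have nonempty: "pverts R \<noteq> {}"
    and reach: "\<And>u v. u \<in> pverts R \<Longrightarrow> v \<in> pverts R \<Longrightarrow>
      (u, v) \<in> rtrancl_on (pverts R) (parcs (mk_symmetric (with_proj R)))"
    using conn by (auto simp: Digraph_Component.connected_def strongly_connected_def reachable_def)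
  have nbr: "\<exists>w. (y, w) \<in> parcs R \<or> (w, y) \<in> parcs R"
    if "y \<in> pverts R" "d \<in> pverts R" "y \<noteq> d" for y d
    using reach[OF that(1,2)] that(3)
    by (cases rule: converse_rtrancl_on_cases) (auto simp: parcs_mk_symmetric)
  show thesis
  proof (cases "0 \<in> pverts R")
    case True
    show thesis
    proof (rule that[OF True])
      fix y assume "y \<in> pverts R"
      then show "y = 0 \<or> (0, y) \<in> parcs R \<or> (y, 0) \<in> parcs R"
        using nbr[OF _ True] arcs by blast
    qed
  next
    case False
    obtain d where d: "d \<in> pverts R" using nonempty by blast
    show thesis
    proof (rule that[OF d])
      fix y assume "y \<in> pverts R"
      with nbr[OF _ d] arcs wf False show "y = d \<or> (d, y) \<in> parcs R \<or> (y, d) \<in> parcs R"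
        by blast
    qed
  qed
qed

text \<open>The centre is pulled back along the isomorphism. Arcs have their own map, but as tail
  and head in \<open>R\<close> are the projections, it sends an arc to the pair of images of its
  ends; injectivity on vertices recovers the arc.\<close>

lemma substructure_of_star_has_centre:
  fixes S :: "'a pair_pre_digraph"
  assumes "subgraph (with_proj R) (with_proj (star r))"
    and "Digraph_Component.connected (with_proj R)"
    and "digraph_iso (with_proj S) (with_proj R)"
  shows "\<exists>c\<in>pverts S. \<forall>x\<in>pverts S. x = c \<or> (c, x) \<in> parcs S \<or> (x, c) \<in> parcs S"
proof -
  obtain d where d: "d \<in> pverts R"
    and nbr: "\<And>y. y \<in> pverts R \<Longrightarrow> y = d \<or> (d, y) \<in> parcs R \<or> (y, d) \<in> parcs R"
    using connected_subgraph_of_star_has_centre[OF assms(1,2)] by blast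
  obtain f where f: "pre_digraph.digraph_isomorphism (with_proj S) f"
    and R: "with_proj R = app_iso f (with_proj S)"
    using assms(3) by (auto simp: digraph_iso_def)
  have verts: "pverts R = iso_verts f ` pverts S" and arcs: "parcs R = iso_arcs f ` parcs S"
    and proj: "iso_tail f = fst" "iso_head f = snd"
    using arg_cong[OF R, of verts] arg_cong[OF R, of arcs]
      arg_cong[OF R, of tail] arg_cong[OF R, of head] by simp_all
  have wf: "wf_digraph (with_proj S)" and inj: "inj_on (iso_verts f) (pverts S)"
    and ends: "\<And>a. a \<in> parcs S \<Longrightarrow> iso_arcs f a = (iso_verts f (fst a), iso_verts f (snd a))"
    using f proj by (auto simp: pre_digraph.digraph_isomorphism_def prod_eq_iff)
  have arcD: "(x, y) \<in> parcs S"
    if xy: "(iso_verts f x, iso_verts f y) \<in> parcs R" "x \<in> pverts S" "y \<in> pverts S" for x y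
  proof -
    obtain a where a: "a \<in> parcs S" "(iso_verts f x, iso_verts f y) = iso_arcs f a"
      using xy(1) by (auto simp: arcs)
    have "fst a \<in> pverts S" "snd a \<in> pverts S" 
      using wf_digraph.tail_in_verts[OF wf, of a] wf_digraph.head_in_verts[OF wf, of a] a(1) by simp_all
    then have "a = (x, y)"
      using a ends[OF a(1)] inj_onD[OF inj] xy(2,3) by (simp add: prod_eq_iff)
    then show ?thesis using a(1) by simp
  qed
  obtain c where c: "c \<in> pverts S" "d = iso_verts f c" using d by (auto simp: verts)
  show ?thesis
  proof (intro bexI[OF _ c(1)] ballI)
    fix x assume x: "x \<in> pverts S"
    then have "iso_verts f x \<in> pverts R" by (simp add: verts)
    from nbr[OF this] show "x = c \<or> (c, x) \<in> parcs S \<or> (x, c) \<in> parcs S"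
      unfolding c(2) using arcD[OF _ x c(1)] arcD[OF _ c(1) x] inj_onD[OF inj _ x c(1)] by blast
  qed
qed

section \<open>Stars as structures and substructures\<close>

lemma digraph_iso_star:
  assumes "c \<notin> L" "finite L" "card L = r"
  shows "digraph_iso (with_proj \<lparr>pverts = insert c L, parcs = {c} \<times> L \<union> L \<times> {c}\<rparr>)
    (with_proj (star r))"
proof -
  let ?S = "\<lparr>pverts = insert c L, parcs = {c} \<times> L \<union> L \<times> {c}\<rparr>"
  obtain g where g: "bij_betw g L {1..r}"
    using finite_same_card_bij[of L "{1..r}"] assms by auto
  define h where "h = g(c := 0)"
  have hL: "h ` L = {1..r}"
    using g assms(1) by (auto simp: h_def bij_betw_def image_iff)
  have injL: "inj_on h L"
    using g assms(1) by (auto simp: h_def bij_betw_def inj_on_def)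
  have hc: "h c = 0" by (simp add: h_def)
  have inj: "inj_on h (insert c L)"
    using injL hL hc assms(1) by (subst inj_on_insert) auto
  let ?f = "\<lparr>iso_verts = h, iso_arcs = map_prod h h, iso_head = snd, iso_tail = fst\<rparr>"
  have "inj_on (map_prod h h) (insert c L \<times> insert c L)"
    using inj by (rule map_prod_inj_on[OF _ inj])
  then have "inj_on (map_prod h h) ({c} \<times> L \<union> L \<times> {c})"
    by (rule inj_on_subset) auto
  then have iso: "pre_digraph.digraph_isomorphism (with_proj ?S) ?f"
    using inj by (auto simp: pre_digraph.digraph_isomorphism_def wf_digraph_def)
  have "map_prod h h ` ({c} \<times> L \<union> L \<times> {c}) = {h c} \<times> h ` L \<union> h ` L \<times> {h c}"
    by force
  then have "map_prod h h ` ({c} \<times> L \<union> L \<times> {c}) = {0} \<times> {1..r} \<union> {1..r} \<times> {0}"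
    unfolding hL hc .
  moreover have "h ` insert c L = {0..r}" using hL hc by auto
  ultimately have "with_proj (star r) = app_iso ?f (with_proj ?S)"
    by (simp add: star_def with_proj_def app_iso_def)
  with iso show ?thesis by (auto simp: digraph_iso_def)
qed

lemma pair_graph_star: "pair_graph (star r)"
proof
  show "finite (pverts (star r))" "finite (parcs (star r))" by (simp_all add: star_def)
qed (auto simp: star_def symmetric_def intro: symI)

lemma connected_star: "Digraph_Component.connected (with_proj (star r))"
proof -
  let ?M = "mk_symmetric (with_proj (star r))"
  have 0: "0 \<in> pverts (star r)" by (simp add: star_def)
  interpret M: pair_wf_digraph ?M
    by (rule wf_digraph.wellformed_mk_symmetric)
      (auto simp: wf_digraph_def star_def)
  have arc: "(0, u) \<in> parcs ?M \<and> (u, 0) \<in> parcs ?M" if "u \<in> pverts (star r)" "u \<noteq> 0" for u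
    using that by (auto simp: parcs_mk_symmetric star_def)
  have "u \<rightarrow>\<^sup>*\<^bsub>?M\<^esub> 0 \<and> 0 \<rightarrow>\<^sup>*\<^bsub>?M\<^esub> u" if "u \<in> pverts (star r)" for u
    using arc[OF that] that 0 by (cases "u = 0") (auto intro: M.reachable_adjI)
  then show ?thesis
    using 0 unfolding Digraph_Component.connected_def strongly_connected_def
    by (auto intro: M.reachable_trans)
qed

text \<open>A star is a connected subgraph of itself. Hence one lower bound serves both kinds of
  cut, and one cut can attain both minima.\<close>

lemma structure_cut_star_imp_substructure_cut:
  assumes "structure_cut G (star r) \<F>"
  shows "substructure_cut G (star r) \<F>"
proof -
  interpret pair_graph "star r" by (rule pair_graph_star)
  show ?thesis
    using assms pair_graph_star connected_star subgraph_refl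
    unfolding structure_cut_def substructure_cut_def by blast
qed

lemma pair_wf_digraph_twisted_hypercube: "pair_wf_digraph (twisted_hypercube n)"
proof (cases "n = 0")
  case True
  then show ?thesis by unfold_locales (auto simp: twisted_hypercube.simps(1))
next
  case False
  then show ?thesis
    by unfold_locales (auto simp: pverts_twisted_hypercube dest: adj_length)
qed

lemma sym_adj: "sym (adj n)"
  by (auto intro: symI adj_sym)

section \<open>The lower bound, for stars with any number of leaves\<close>

lemma card_substructure_cut_star:
  assumes "n \<noteq> 0" "finite \<F>" and cut: "substructure_cut (twisted_hypercube n) (star r) \<F>"
  shows "n \<le> 2 * card \<F>"
proof (rule ccontr)
  assume less: "\<not> n \<le> 2 * card \<F>"
  let ?H = "twisted_hypercube n"
  define X where "X = (\<Union>S\<in>\<F>. pverts S)"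
  have "\<exists>c\<in>pverts S. pverts S \<subseteq> insert c (adj n `` {c})" if "S \<in> \<F>" for S
  proof -
    obtain R where "subgraph (with_proj R) (with_proj (star r))"
      "Digraph_Component.connected (with_proj R)" "digraph_iso (with_proj S) (with_proj R)"
      using cut \<open>S \<in> \<F>\<close> by (auto simp: substructure_cut_def)
    then obtain c where c: "c \<in> pverts S"
      "\<And>x. x \<in> pverts S \<Longrightarrow> x = c \<or> (c, x) \<in> parcs S \<or> (x, c) \<in> parcs S"
      using substructure_of_star_has_centre by blast
    have "parcs S \<subseteq> adj n"
      using cut \<open>S \<in> \<F>\<close> by (auto simp: substructure_cut_def subgraph_def)
    then show ?thesis using c adj_sym by blast
  qed
  then have "\<forall>S\<in>\<F>. \<exists>c. c \<in> pverts S \<and> pverts S \<subseteq> insert c (adj n `` {c})" by blast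
  then obtain ctr where ctr: "\<And>S. S \<in> \<F> \<Longrightarrow> ctr S \<in> pverts S"
    "\<And>S. S \<in> \<F> \<Longrightarrow> pverts S \<subseteq> insert (ctr S) (adj n `` {ctr S})"
    by (auto dest!: bchoice)
  obtain u v where uv: "u \<in> pverts ?H - X" "v \<in> pverts ?H - X"
    and unreachable: "(u, v) \<notin> (adj n \<inter> (pverts ?H - X) \<times> (pverts ?H - X))\<^sup>*"
    using cut sym_adj unfolding substructure_cut_def X_def
    by (auto simp: disconnected_delete_subgraphs_iff)
  have "(u, v) \<in> (adj n \<inter> (- X) \<times> (- X))\<^sup>*"
  proof (rule fault_connected)
    show "finite (ctr ` \<F>)" using assms(2) by simp
    show "ctr ` \<F> \<subseteq> X" using ctr(1) by (auto simp: X_def)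
    show "X \<subseteq> ctr ` \<F> \<union> {} \<union> adj n `` ctr ` \<F>" using ctr(2) unfolding X_def by blast
    \<comment> \<open>Every member counts as a star of weight 2, even if it is a single vertex, so
      there are no single faults. Members may share a centre, hence only an inequality.\<close>
    show "2 * card (ctr ` \<F>) + card {} \<le> n - 1"
      using card_image_le[OF assms(2), of ctr] less by simp
  qed (use uv assms(1) in \<open>auto simp: pverts_twisted_hypercube\<close>)
  moreover have "adj n \<inter> (- X) \<times> (- X) \<subseteq> adj n \<inter> (pverts ?H - X) \<times> (pverts ?H - X)"
    using assms(1) by (auto simp: pverts_twisted_hypercube dest: adj_length)
  ultimately show False using unreachable rtrancl_mono[THEN subsetD] by metis
qed

section \<open>Isolating the zero string\<close>

definition unit_string :: "nat \<Rightarrow> nat \<Rightarrow> bool list" where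
  "unit_string n i = replicate i False @ True # replicate (n - Suc i) False"

lemma twist_replicate_False: "twist (replicate n False) = replicate n False"
proof (cases "n = 0")
  case True
  then show ?thesis by (simp add: twist_def)
next
  case False
  then have w: "2 * twist_width n \<le> n" by (rule two_twist_width_le)
  show ?thesis
  proof (rule nth_equalityI)
    fix j assume "j < length (twist (replicate n False))"
    then show "twist (replicate n False) ! j = replicate n False ! j"
      using w by (simp add: twist_def Let_def)
  qed simp
qed

text \<open>The letters added to the prefix come from the second half of the string and so miss the
  leading \<open>True\<close>. At this string and at zero, cross edges are those of the ordinary
  hypercube.\<close>

lemma twist_True_replicate_False: "twist (True # replicate n False) = True # replicate n False"
proof (rule nth_equalityI)
  have w: "2 * twist_width (Suc n) \<le> Suc n" by (rule two_twist_width_le) simp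
  fix j assume j: "j < length (twist (True # replicate n False))"
  show "twist (True # replicate n False) ! j = (True # replicate n False) ! j"
  proof (cases "j < twist_width (Suc n)")
    case True
    then obtain i where i: "Suc n - twist_width (Suc n) + j = Suc i" "i < n"
      using w by (cases "Suc n - twist_width (Suc n) + j") auto
    then show ?thesis using j True by (simp add: twist_def Let_def del: upt_Suc)
  next
    case False
    then show ?thesis using j by (simp add: twist_def Let_def del: upt_Suc)
  qed
qed simp

lemma adj_append: "(x, y) \<in> adj n \<Longrightarrow> (p @ x, p @ y) \<in> adj (length p + n)"
  by (induction p) (simp_all add: adj_Cons)

lemma Image_adj_zero: "adj n `` {replicate n False} = unit_string n ` {..<n}"
proof (induction n)
  case (Suc n)
  have "unit_string (Suc n) ` {..<Suc n} =
      insert (True # replicate n False) (Cons False ` unit_string n ` {..<n})"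
    by (simp add: lessThan_Suc_eq_insert_0 image_image unit_string_def)
  then show ?case
    using Suc.IH Image_adj_Cons[of "replicate n False" n False]
    by (simp add: twist_replicate_False)
qed (simp add: adj_0)

text \<open>The witness has \<open>True\<close> exactly at positions \<open>i\<close> and
  \<open>i + 1\<close>. Because these are consecutive, removing the common leading zeros leaves only
  edges along which \<open>twist\<close> acts trivially.\<close>

lemma unit_strings_common_neighbour:
  assumes "Suc i < n"
  obtains c where "length c = n" "(c, unit_string n i) \<in> adj n" "(c, unit_string n (Suc i)) \<in> adj n"
    "c \<notin> insert (replicate n False) (adj n `` {replicate n False})"
proof -
  obtain k where n: "n = i + Suc (Suc k)" using assms by (auto simp: less_iff_Suc_add)
  define c where "c = replicate i False @ True # True # replicate k False"
  have H0: "length c = n" by (simp add: c_def n)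
  have "unit_string n i = replicate i False @ True # False # replicate k False"
    by (simp add: unit_string_def n)
  moreover have "(True # True # replicate k False, True # False # replicate k False) \<in> adj (Suc (Suc k))"
    by (simp add: adj_Cons twist_replicate_False)
  ultimately have H1: "(c, unit_string n i) \<in> adj n"
    using adj_append[of _ _ "Suc (Suc k)" "replicate i False"] by (simp add: c_def n)
  have "unit_string n (Suc i) = replicate i False @ False # True # replicate k False"
    by (simp add: unit_string_def n replicate_app_Cons_same)
  moreover have "(True # True # replicate k False, False # True # replicate k False) \<in> adj (Suc (Suc k))"
    by (simp add: adj_Cons twist_True_replicate_False)
  ultimately have H2: "(c, unit_string n (Suc i)) \<in> adj n"
    using adj_append[of _ _ "Suc (Suc k)" "replicate i False"] by (simp add: c_def n)
  \<comment> \<open>The number of \<open>True\<close> letters is 0, 2 and 1, respectively, which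
    separates \<open>c\<close> from zero and all its neighbours.\<close>
  have "filter id (replicate n False) = []" "filter id c = [True, True]"
    "filter id (unit_string n j) = [True]" for j
    by (simp_all add: c_def unit_string_def)
  then have H3: "c \<notin> insert (replicate n False) (adj n `` {replicate n False})"
    by (auto simp: Image_adj_zero)
  show thesis by (rule that[OF H0 H1 H2 H3])
qed

text \<open>A structure cut needs complete stars: the prescribed leaves \<open>W\<close> are filled
  up to exactly \<open>r\<close> neighbours of \<open>c\<close> without using \<open>v\<close>, the
  vertex to be isolated.\<close>

lemma ex_star_avoiding:
  assumes "length c = n" "v \<noteq> c" "W \<subseteq> adj n `` {c} - {v}" "card W \<le> r"
    and "r \<le> card (adj n `` {c} - {v})" and "n \<noteq> 0"
  shows "\<exists>S. subgraph (with_proj S) (with_proj (twisted_hypercube n)) \<and>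
    digraph_iso (with_proj S) (with_proj (star r)) \<and>
    insert c W \<subseteq> pverts S \<and> v \<notin> pverts S \<and> finite (pverts S) \<and> card (pverts S) = Suc r"
proof -
  have fin: "finite (adj n `` {c})" using finite_card_Image_adj[OF assms(1)] by simp
  obtain L where L: "W \<subseteq> L" "L \<subseteq> adj n `` {c} - {v}" "card L = r"
    using exists_subset_between[OF assms(4,5,3)] fin by auto
  have finL: "finite L" using finite_subset[OF L(2)] fin by simp
  have cL: "c \<notin> L" using L(2) adj_irrefl by auto
  let ?S = "\<lparr>pverts = insert c L, parcs = {c} \<times> L \<union> L \<times> {c}\<rparr>"
  have "subgraph (with_proj ?S) (with_proj (twisted_hypercube n))"
  proof (rule subgraphI)
    show "verts (with_proj ?S) \<subseteq> verts (with_proj (twisted_hypercube n))"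
      using L(2) assms(1,6) by (auto simp: pverts_twisted_hypercube dest: adj_length)
    show "arcs (with_proj ?S) \<subseteq> arcs (with_proj (twisted_hypercube n))"
      using L(2) by (auto intro: adj_sym)
    show "compatible (with_proj (twisted_hypercube n)) (with_proj ?S)" ..
    show "wf_digraph (with_proj ?S)" by (auto simp: wf_digraph_def)
    show "wf_digraph (with_proj (twisted_hypercube n))"
      using pair_wf_digraph_twisted_hypercube by (simp add: wf_digraph_wp_iff)
  qed
  moreover have "digraph_iso (with_proj ?S) (with_proj (star r))"
    by (rule digraph_iso_star[OF cL finL L(3)])
  ultimately show ?thesis
    using L finL cL assms(2) by (intro exI[of _ ?S]) auto
qed

section \<open>The cut that isolates the zero string\<close>

lemma ex_structure_cut_star_4:
  assumes "4 \<le> n"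
  shows "\<exists>\<F>. finite \<F> \<and> card \<F> \<le> Suc n div 2 \<and>
    structure_cut (twisted_hypercube n) (star 4) \<F>"
proof -
  let ?H = "twisted_hypercube n"
  let ?v = "replicate n False"
  have n0: "n \<noteq> 0" using assms by simp
  \<comment> \<open>Star \<open>j\<close> covers the unit strings with indices \<open>2 * j\<close>
    and \<open>2 * j + 1\<close>, hence the grouping by \<open>i div 2\<close>. Its size is kept for
    the count below.\<close>
  define good where "good j S \<longleftrightarrow> subgraph (with_proj S) (with_proj ?H) \<and>
      digraph_iso (with_proj S) (with_proj (star 4)) \<and>
      unit_string n ` {i. i < n \<and> i div 2 = j} \<subseteq> pverts S \<and> ?v \<notin> pverts S \<and>
      finite (pverts S) \<and> card (pverts S) = Suc 4" for j S
  have "\<exists>S. good j S"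
    if j: "j < Suc n div 2" for j
  proof (cases "Suc (2 * j) < n")
    case True
    obtain c where c: "length c = n" "(c, unit_string n (2 * j)) \<in> adj n"
      "(c, unit_string n (Suc (2 * j))) \<in> adj n" "c \<noteq> ?v" "(?v, c) \<notin> adj n"
      using unit_strings_common_neighbour[OF True] by blast
    let ?W = "{unit_string n (2 * j), unit_string n (Suc (2 * j))}"
    have cv: "?v \<notin> adj n `` {c}" using c(5) adj_sym by auto
    have "card ?W \<le> 4" by (simp add: card_insert_if)
    moreover have "?W \<subseteq> adj n `` {c} - {?v}" using c(2,3) cv by auto
    moreover have "4 \<le> card (adj n `` {c} - {?v})"
      using finite_card_Image_adj[OF c(1)] cv assms by simp
    ultimately obtain S where S: "subgraph (with_proj S) (with_proj ?H)"
      "digraph_iso (with_proj S) (with_proj (star 4))"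
      "insert c ?W \<subseteq> pverts S" "?v \<notin> pverts S" "finite (pverts S)" "card (pverts S) = Suc 4"
      using ex_star_avoiding[of c n ?v ?W 4, OF c(1) c(4)[symmetric]] n0 by blast
    moreover have "{i. i < n \<and> i div 2 = j} \<subseteq> {2 * j, Suc (2 * j)}"
      by (rule subsetI, simp) linarith
    from image_mono[OF this, of "unit_string n"]
    have "unit_string n ` {i. i < n \<and> i div 2 = j} \<subseteq> pverts S"
      by (rule order_trans) (use S(3) in simp)
    ultimately show ?thesis unfolding good_def by blast
  next
    case False
    with j have n: "n = Suc (2 * j)" by linarith
    \<comment> \<open>For odd \<open>n\<close> the last unit string is unpaired and serves as a
      centre itself. It is adjacent to zero, which costs one possible leaf, but odd n >= 4 means n
      >= 5, so four remain.\<close>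
    let ?c = "unit_string n (2 * j)"
    have c: "length ?c = n" by (simp add: unit_string_def n)
    have "True \<in> set ?c" "True \<notin> set ?v" by (simp_all add: unit_string_def)
    then have ne: "?v \<noteq> ?c" by force
    have "4 \<le> n - Suc 0" using n assms by presburger
    then have "4 \<le> card (adj n `` {?c} - {?v})"
      using finite_card_Image_adj[OF c] assms by (simp add: card_Diff_singleton_if)
    then obtain S where S: "subgraph (with_proj S) (with_proj ?H)"
      "digraph_iso (with_proj S) (with_proj (star 4))"
      "?c \<in> pverts S" "?v \<notin> pverts S" "finite (pverts S)" "card (pverts S) = Suc 4"
      using ex_star_avoiding[OF c ne, of "{}" 4] n0 by auto
    moreover have "{i. i < n \<and> i div 2 = j} \<subseteq> {2 * j}"
      using n by (intro subsetI, simp) linarith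
    from image_mono[OF this, of "unit_string n"]
    have "unit_string n ` {i. i < n \<and> i div 2 = j} \<subseteq> pverts S"
      by (rule order_trans) (use S(3) in simp)
    ultimately show ?thesis unfolding good_def by blast
  qed
  then have "\<forall>j\<in>{..<Suc n div 2}. \<exists>S. good j S" by simp
  from bchoice[OF this] obtain S where good: "\<forall>j\<in>{..<Suc n div 2}. good j (S j)" ..
  have S: "subgraph (with_proj (S j)) (with_proj ?H)"
    "digraph_iso (with_proj (S j)) (with_proj (star 4))"
    "unit_string n ` {i. i < n \<and> i div 2 = j} \<subseteq> pverts (S j)"
    "?v \<notin> pverts (S j)" "finite (pverts (S j))" "card (pverts (S j)) = Suc 4"
    if "j < Suc n div 2" for j
    using good[THEN bspec, of j] that unfolding good_def lessThan_iff by blast+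
  define \<F> where "\<F> = S ` {..<Suc n div 2}"
  define X where "X = (\<Union>T\<in>\<F>. pverts T)"
  have v: "?v \<in> pverts ?H - X"
    unfolding X_def \<F>_def pverts_twisted_hypercube[OF n0] using S(4) by simp
  have nbrs: "adj n `` {?v} \<subseteq> X"
  proof -
    have "unit_string n i \<in> X" if "i < n" for i
    proof -
      have "i div 2 < Suc n div 2" using that by linarith
      then show ?thesis using S(3)[of "i div 2"] that unfolding X_def \<F>_def by blast
    qed
    then show ?thesis by (auto simp: Image_adj_zero)
  qed
  have finX: "finite X" using S(5) by (simp add: X_def \<F>_def)
  \<comment> \<open>Isolating zero disconnects only if another vertex survives. With five vertices
    per star, fewer than 4n <= 2^n strings are deleted or zero.\<close>
  have "card X \<le> (\<Sum>j<Suc n div 2. card (pverts (S j)))"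
    unfolding X_def \<F>_def using card_UN_le[of "{..<Suc n div 2}" "\<lambda>j. pverts (S j)"] by simp
  also have "\<dots> = (\<Sum>j<Suc n div 2. 5)" by (rule sum.cong) (simp_all add: S(6))
  finally have "card (insert ?v X) \<le> 5 * (Suc n div 2) + 1"
    using finX by (simp add: card_insert_if)
  also have "\<dots> < 4 * n"
    using assms by linarith
  also have "\<dots> \<le> n\<^sup>2" using assms by (simp add: power2_eq_square)
  also have "\<dots> \<le> 2 ^ n" using assms by (rule square_le_power_two)
  also have "\<dots> = card {x :: bool list. length x = n}"
    using card_lists_length_eq[of "UNIV :: bool set" n] by simp
  finally have "\<not> {x :: bool list. length x = n} \<subseteq> insert ?v X"
    using card_mono[of "insert ?v X" "{x :: bool list. length x = n}"] finX
    by (meson finite_insert not_less)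
  then obtain w where w: "w \<in> pverts ?H - X" "w \<noteq> ?v"
    unfolding pverts_twisted_hypercube[OF n0] by blast
  have "(?v, w) \<notin> (adj n \<inter> (pverts ?H - X) \<times> (pverts ?H - X))\<^sup>*"
  proof
    assume "(?v, w) \<in> (adj n \<inter> (pverts ?H - X) \<times> (pverts ?H - X))\<^sup>*"
    then show False
    proof (cases rule: converse_rtranclE)
      case base
      then show ?thesis using w(2) by simp
    next
      case (step y)
      then show ?thesis using nbrs by blast
    qed
  qed
  then have "disconnected (delete_subgraphs ?H \<F>)"
    unfolding disconnected_delete_subgraphs_iff[OF sym_adj] X_def[symmetric] using v w(1) by blast
  then have "structure_cut ?H (star 4) \<F>"
    unfolding structure_cut_def using S(1,2) by (simp add: \<F>_def)
  \<comment> \<open>The chosen stars are not shown to be distinct; equality will follow from the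
    lower bound.\<close>
  moreover have "card \<F> \<le> Suc n div 2"
    using card_image_le[of "{..<Suc n div 2}" S] by (simp add: \<F>_def)
  ultimately show ?thesis by (intro exI[of _ \<F>]) (simp add: \<F>_def)
qed

theorem theorem3p9:
  fixes n :: nat
  assumes "n \<ge> 4"
  shows "structure_connectivity (twisted_hypercube n) (star 4) =
           substructure_connectivity (twisted_hypercube n) (star 4) \<and>
         int (substructure_connectivity (twisted_hypercube n) (star 4)) = \<lceil>real n / 2\<rceil>"
proof -
  let ?H = "twisted_hypercube n" and ?k = "Suc n div 2"
  have lower: "?k \<le> card \<F>" if "finite \<F>" "substructure_cut ?H (star 4) \<F>" for \<F>
    using card_substructure_cut_star[OF _ that] assms by linarith
  obtain \<F> where \<F>: "finite \<F>" "card \<F> \<le> ?k" "structure_cut ?H (star 4) \<F>"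
    using ex_structure_cut_star_4[OF assms] by blast
  \<comment> \<open>This cut belongs to both families and meets their common lower bound, so both
    infima are attained minima and not the default value 0.\<close>
  then have card: "?k = card \<F>"
    using lower structure_cut_star_imp_substructure_cut by (blast intro: le_antisym)
  have "structure_connectivity ?H (star 4) = ?k"
    unfolding structure_connectivity_def
    by (rule cInf_eq_minimum) (use \<F> card lower structure_cut_star_imp_substructure_cut in blast)+
  moreover have "substructure_connectivity ?H (star 4) = ?k"
    unfolding substructure_connectivity_def
    by (rule cInf_eq_minimum) (use \<F> card lower structure_cut_star_imp_substructure_cut in blast)+
  moreover have "\<lceil>real n / 2\<rceil> = int ?k"
    by (rule ceiling_unique) linarith+
  ultimately show ?thesis by simp
qed

end
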